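(* There exists a non-closable linear operator $A$ (on some Hilbert space) that has no closable square root, i.e. there is no closable linear operator $B$ with $B^2=A$.
   Context: Hilbert spaces are complex. An operator $T$ with domain $D(T)\subset H$ is closable if, for every sequence $(x_k)$ in $D(T)$ with $x_k\to 0$ and $Tx_k\to y$, one has $y=0$. For linear operators with domains, $D(ST)=\{x\in D(T): Tx\in D(S)\}$. An operator $B$ is a square root of $A$ if $B^2=A$, with equality of domains $D(B^2)=D(A)$. *)

theory Defs
  imports Complex_Main "HOL-Library.Function_Algebras"
begin

text \<open>
  A complex Hilbert space is a subspace \<open>H\<close> of a complex vector space (with scalar multiplication
  \<open>scale\<close>), together with a complete inner product \<open>ip\<close> on \<open>H\<close>, linear in its first argument.
  The values of \<open>ip\<close> outside \<open>H\<close> are irrelevant. Working with a carrier set rather than a type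
  makes it possible to quantify existentially over Hilbert spaces. The realness of \<open>ip x x\<close> follows
  from conjugate symmetry.
\<close>

locale complex_hilbert_space = vector_space scale
  for scale :: "complex \<Rightarrow> 'a::ab_group_add \<Rightarrow> 'a" +
  fixes H :: "'a set"
    and ip :: "'a \<Rightarrow> 'a \<Rightarrow> complex"
  assumes subspace_carrier: "subspace H"
    and ip_add_left: "\<lbrakk>x \<in> H; y \<in> H; z \<in> H\<rbrakk> \<Longrightarrow> ip (x + y) z = ip x z + ip y z"
    and ip_scale_left: "\<lbrakk>x \<in> H; y \<in> H\<rbrakk> \<Longrightarrow> ip (scale c x) y = c * ip x y"
    and ip_commute: "\<lbrakk>x \<in> H; y \<in> H\<rbrakk> \<Longrightarrow> ip y x = cnj (ip x y)"
    and ip_pos: "\<lbrakk>x \<in> H; x \<noteq> 0\<rbrakk> \<Longrightarrow> 0 < Re (ip x x)"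
    and complete:
      "\<lbrakk>\<And>n. X n \<in> H;
        \<And>e. e > 0 \<Longrightarrow> \<exists>N. \<forall>m\<ge>N. \<forall>n\<ge>N. sqrt (Re (ip (X m - X n) (X m - X n))) < e\<rbrakk>
       \<Longrightarrow> \<exists>l\<in>H. (\<lambda>n. sqrt (Re (ip (X n - l) (X n - l)))) \<longlonglongrightarrow> 0"
begin

definition hnorm :: "'a \<Rightarrow> real" where
  "hnorm x = sqrt (Re (ip x x))"

definition converges_to :: "(nat \<Rightarrow> 'a) \<Rightarrow> 'a \<Rightarrow> bool" where
  "converges_to X l \<longleftrightarrow> (\<lambda>n. hnorm (X n - l)) \<longlonglongrightarrow> 0"

text \<open>
  An operator \<open>T\<close> with domain \<open>D(T)\<close> is a partial map with \<open>dom T = D(T)\<close>. Equality of partial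
  maps includes equality of domains, and \<open>S \<circ>\<^sub>m T\<close> is the product \<open>ST\<close> on its natural domain
  (see \<open>dom_map_comp_operator\<close> below).
\<close>

definition linear_operator :: "('a \<rightharpoonup> 'a) \<Rightarrow> bool" where
  "linear_operator T \<longleftrightarrow>
     subspace (dom T) \<and> dom T \<subseteq> H \<and> ran T \<subseteq> H \<and>
     (\<forall>x\<in>dom T. \<forall>y\<in>dom T. the (T (x + y)) = the (T x) + the (T y)) \<and>
     (\<forall>c. \<forall>x\<in>dom T. the (T (scale c x)) = scale c (the (T x)))"

definition closable :: "('a \<rightharpoonup> 'a) \<Rightarrow> bool" where
  "closable T \<longleftrightarrow>
     (\<forall>X. \<forall>y\<in>H. (\<forall>k. X k \<in> dom T) \<longrightarrow> converges_to X 0 \<longrightarrow>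
        converges_to (\<lambda>k. the (T (X k))) y \<longrightarrow> y = 0)"

definition square_root :: "('a \<rightharpoonup> 'a) \<Rightarrow> ('a \<rightharpoonup> 'a) \<Rightarrow> bool" where
  "square_root B A \<longleftrightarrow> B \<circ>\<^sub>m B = A"

end

lemma dom_map_comp_operator: "dom (S \<circ>\<^sub>m T) = {x \<in> dom T. the (T x) \<in> dom S}"
  by (auto simp: map_comp_def split: option.splits)

end

theory Submission
  imports Defs "HOL-Computational_Algebra.Polynomial"
begin

text \<open>
  The operator constructed here has no linear square root at all. The
  obstruction is algebraic: multiplication by the variable \<open>X\<close> on the polynomial ring has no linear
  square root. A square root \<open>C\<close> would commute with its square, multiplication by \<open>X\<close>, hence would
  be multiplication by the polynomial \<open>q = C 1\<close>; then \<open>q\<^sup>2 = X\<close>, which is impossible because \<open>q\<^sup>2\<close>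
  has even degree (\<open>mult_X_no_square_root\<close>).

  It remains to realise multiplication by \<open>X\<close> as a non-closable operator. The polynomials are
  embedded into \<open>\<ell>\<^sup>2\<close> by an injective linear map \<open>\<phi>\<close> chosen such that the even powers of \<open>X\<close> tend
  to \<open>0\<close> while the odd powers tend to a nonzero vector; the operator \<open>A (\<phi> p) = \<phi> (X p)\<close>, defined on
  the range of \<open>\<phi>\<close>, is then not closable (\<open>not_closable_embedded_X\<close>).

  A square root \<open>B\<close> of \<open>A\<close> could a priori have a larger domain than \<open>A\<close> and map the domain of \<open>A\<close>
  outside itself. Neither helps: \<open>A\<close> maps its domain \<open>D\<close> to itself, so for \<open>x \<in> D\<close> the vector
  \<open>B (B x) = A x\<close> lies in \<open>D \<subseteq> D(B)\<close>, which means that \<open>B x \<in> D(B\<^sup>2) = D\<close>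
  (\<open>square_root_maps_domain\<close>). Thus \<open>B\<close> restricts to \<open>D\<close> and pulls back along \<open>\<phi>\<close> to a square root
  of multiplication by \<open>X\<close>.
\<close>

section \<open>Multiplication by the variable has no square root\<close>

text \<open>
  The square root commutes with multiplication by \<open>X\<close> because \<open>C (C (C p))\<close> can be bracketed in two
  ways; together with linearity this makes it multiplication by \<open>C 1\<close>.
\<close>

lemma mult_X_no_square_root:
  fixes C :: "'a::idom poly \<Rightarrow> 'a poly"
  assumes add: "\<And>p q. C (p + q) = C p + C q"
    and smult: "\<And>a p. C (smult a p) = smult a (C p)"
    and square: "\<And>p. C (C p) = pCons 0 p"
  shows False
proof -
  have commute: "C (pCons 0 p) = pCons 0 (C p)" for p
    by (metis square)
  have mult: "C p = p * C 1" for p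
  proof (induction p)
    case 0
    show ?case using smult[of 0 0] by simp
  next
    case (pCons a p)
    have "C (pCons a p) = C (smult a 1 + pCons 0 p)" by (simp add: one_pCons)
    also have "\<dots> = smult a (C 1) + pCons 0 (p * C 1)"
      by (simp only: add smult commute pCons.IH)
    finally show ?case by simp
  qed
  have "C 1 * C 1 = [:0, 1:]"
    using square[of 1] mult[of "C 1"] by (simp add: one_pCons)
  moreover from this have "C 1 \<noteq> 0" by auto
  ultimately have "2 * degree (C 1) = 1"
    using degree_mult_eq[of "C 1" "C 1"] by simp
  then show False by presburger
qed

text \<open>
  The domain of \<open>A = B\<^sup>2\<close> consists of the vectors \<open>z\<close> for which both \<open>z\<close> and \<open>B z\<close> belong to \<open>D(B)\<close>.
  For \<open>z = B x\<close> the second condition says \<open>A x \<in> D(B)\<close>, which the invariance of \<open>D(A)\<close> provides.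
\<close>

lemma square_root_maps_domain:
  assumes root: "B \<circ>\<^sub>m B = A" and invariant: "ran A \<subseteq> dom A" and x: "x \<in> dom A"
  shows "x \<in> dom B" and "the (B x) \<in> dom A" and "the (B (the (B x))) = the (A x)"
proof -
  have dom: "dom A = {x \<in> dom B. the (B x) \<in> dom B}"
    using dom_map_comp_operator[of B B] root by simp
  show B: "x \<in> dom B" using x dom by blast
  then show BB: "the (B (the (B x))) = the (A x)"
    using root by (auto simp: map_comp_def)
  have "the (A x) \<in> dom A"
    using x invariant by (auto simp: ran_def)
  then show "the (B x) \<in> dom A"
    using x BB unfolding dom by auto
qed

section \<open>The Hilbert space of square-summable sequences\<close>

definition ell2_scale :: "complex \<Rightarrow> (nat \<Rightarrow> complex) \<Rightarrow> nat \<Rightarrow> complex" where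
  "ell2_scale c x = (\<lambda>k. c * x k)"

definition ell2 :: "(nat \<Rightarrow> complex) set" where
  "ell2 = {x. summable (\<lambda>k. (cmod (x k))\<^sup>2)}"

definition ell2_ip :: "(nat \<Rightarrow> complex) \<Rightarrow> (nat \<Rightarrow> complex) \<Rightarrow> complex" where
  "ell2_ip x y = (\<Sum>k. x k * cnj (y k))"

interpretation ell2: vector_space ell2_scale
  by unfold_locales (auto simp: ell2_scale_def fun_eq_iff algebra_simps)

lemma ell2_add: "x + y \<in> ell2" if "x \<in> ell2" "y \<in> ell2"
proof -
  have "summable (\<lambda>k. 2 * (cmod (x k))\<^sup>2 + 2 * (cmod (y k))\<^sup>2)"
    using that by (auto simp: ell2_def intro!: summable_add summable_mult)
  moreover have "(cmod (x k + y k))\<^sup>2 \<le> 2 * (cmod (x k))\<^sup>2 + 2 * (cmod (y k))\<^sup>2" for k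
  proof -
    have "(cmod (x k + y k))\<^sup>2 \<le> (cmod (x k) + cmod (y k))\<^sup>2"
      by (intro power_mono norm_triangle_ineq) auto
    also have "\<dots> \<le> 2 * (cmod (x k))\<^sup>2 + 2 * (cmod (y k))\<^sup>2"
      using sum_squares_bound[of "cmod (x k)" "cmod (y k)"] by (simp add: power2_sum)
    finally show ?thesis .
  qed
  ultimately show ?thesis
    by (auto simp: ell2_def intro: summable_comparison_test')
qed

lemma ell2_scale: "ell2_scale c x \<in> ell2" if "x \<in> ell2"
  using that
  by (auto simp: ell2_def ell2_scale_def norm_mult power_mult_distrib intro: summable_mult)

lemma ell2_diff: "x - y \<in> ell2" if "x \<in> ell2" "y \<in> ell2"
proof -
  have "x - y = x + ell2_scale (-1) y" by (simp add: fun_eq_iff ell2_scale_def)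
  with that show ?thesis by (simp only: ell2_add ell2_scale)
qed

lemma subspace_ell2: "ell2.subspace ell2"
  by (auto simp: ell2.subspace_def ell2_add ell2_scale) (simp add: ell2_def)

lemma summable_ell2_ip: "summable (\<lambda>k. x k * cnj (y k))" if "x \<in> ell2" "y \<in> ell2"
proof (rule summable_norm_cancel, rule summable_comparison_test')
  show "summable (\<lambda>k. (cmod (x k))\<^sup>2 + (cmod (y k))\<^sup>2)"
    using that by (auto simp: ell2_def intro: summable_add)
  show "norm (norm (x k * cnj (y k))) \<le> (cmod (x k))\<^sup>2 + (cmod (y k))\<^sup>2" if "k \<ge> 0" for k
  proof -
    have "0 \<le> cmod (x k) * cmod (y k)" by simp
    then have "cmod (x k) * cmod (y k) \<le> (cmod (x k))\<^sup>2 + (cmod (y k))\<^sup>2"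
      using sum_squares_bound[of "cmod (x k)" "cmod (y k)"] by linarith
    then show ?thesis by (simp add: norm_mult)
  qed
qed

lemma ell2_ip_self: "ell2_ip x x = of_real (\<Sum>k. (cmod (x k))\<^sup>2)" if "x \<in> ell2"
  using that
  by (simp add: ell2_ip_def ell2_def complex_norm_square[symmetric] suminf_of_real)

lemma ell2_partial_sum_le: "(\<Sum>k<n. (cmod (x k))\<^sup>2) \<le> Re (ell2_ip x x)" if "x \<in> ell2"
  using that by (auto simp: ell2_ip_self ell2_def intro: sum_le_suminf)

lemma ell2_norm_coordinate_le: "cmod (x k) \<le> sqrt (Re (ell2_ip x x))" if "x \<in> ell2"
proof (rule real_le_rsqrt)
  have "(cmod (x k))\<^sup>2 \<le> (\<Sum>i<Suc k. (cmod (x i))\<^sup>2)" by (simp add: sum_nonneg)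
  with ell2_partial_sum_le[OF that, of "Suc k"] show "(cmod (x k))\<^sup>2 \<le> Re (ell2_ip x x)"
    by linarith
qed

text \<open>
  A Cauchy sequence converges in each coordinate. That the coordinatewise limit is square-summable
  and is the limit in norm both follow by letting \<open>m\<close> tend to infinity in a fixed partial sum of
  the squared norm of \<open>X m - X n\<close>: a finite sum is compatible with the coordinatewise limit, and the
  bound is uniform in the length of the sum.
\<close>

lemma ell2_complete:
  assumes X: "\<And>n. X n \<in> ell2"
    and Cauchy: "\<And>e. e > 0 \<Longrightarrow>
      \<exists>N. \<forall>m\<ge>N. \<forall>n\<ge>N. sqrt (Re (ell2_ip (X m - X n) (X m - X n))) < e"
  shows "\<exists>l\<in>ell2. (\<lambda>n. sqrt (Re (ell2_ip (X n - l) (X n - l)))) \<longlonglongrightarrow> 0"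
proof -
  have "Cauchy (\<lambda>n. X n k)" for k
  proof (rule metric_CauchyI)
    fix e :: real assume "e > 0"
    from Cauchy[OF this] obtain N
      where N: "\<And>m n. m \<ge> N \<Longrightarrow> n \<ge> N \<Longrightarrow> sqrt (Re (ell2_ip (X m - X n) (X m - X n))) < e"
      by blast
    have "dist (X m k) (X n k) < e" if "m \<ge> N" "n \<ge> N" for m n
      using ell2_norm_coordinate_le[OF ell2_diff[OF X X], of m n k] N[OF that]
      by (simp add: dist_norm)
    then show "\<exists>N. \<forall>m\<ge>N. \<forall>n\<ge>N. dist (X m k) (X n k) < e" by blast
  qed
  then obtain l where l: "\<And>k. (\<lambda>n. X n k) \<longlonglongrightarrow> l k"
    unfolding Cauchy_convergent_iff convergent_def by metis
  have close: "\<exists>N. \<forall>n\<ge>N. X n - l \<in> ell2 \<and> sqrt (Re (ell2_ip (X n - l) (X n - l))) \<le> e"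
    if "e > 0" for e
  proof -
    from Cauchy[OF that] obtain N
      where N: "\<And>m n. m \<ge> N \<Longrightarrow> n \<ge> N \<Longrightarrow> sqrt (Re (ell2_ip (X m - X n) (X m - X n))) < e"
      by blast
    have "X n - l \<in> ell2 \<and> sqrt (Re (ell2_ip (X n - l) (X n - l))) \<le> e" if n: "n \<ge> N" for n
    proof -
      have partial: "(\<Sum>k<K. (cmod ((X n - l) k))\<^sup>2) \<le> e\<^sup>2" for K
      proof (rule tendsto_upperbound)
        show "(\<lambda>m. \<Sum>k<K. (cmod ((X n - X m) k))\<^sup>2) \<longlonglongrightarrow> (\<Sum>k<K. (cmod ((X n - l) k))\<^sup>2)"
          by (auto intro!: tendsto_intros l)
        have "(\<Sum>k<K. (cmod ((X n - X m) k))\<^sup>2) \<le> e\<^sup>2" if "m \<ge> N" for m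
        proof -
          have "Re (ell2_ip (X n - X m) (X n - X m)) \<le> e\<^sup>2"
            using N[OF n that] \<open>e > 0\<close> by (simp add: sqrt_le_D)
          with ell2_partial_sum_le[OF ell2_diff[OF X X]] show ?thesis
            by (rule order_trans)
        qed
        then show "\<forall>\<^sub>F m in sequentially. (\<Sum>k<K. (cmod ((X n - X m) k))\<^sup>2) \<le> e\<^sup>2"
          by (auto simp: eventually_sequentially)
      qed simp
      have "summable (\<lambda>k. (cmod ((X n - l) k))\<^sup>2)"
        using partial by (intro summableI_nonneg_bounded[where x = "e\<^sup>2"]) simp_all
      then have mem: "X n - l \<in> ell2" and "(\<Sum>k. (cmod ((X n - l) k))\<^sup>2) \<le> e\<^sup>2"
        using partial by (simp_all add: ell2_def suminf_le_const)
      then have "Re (ell2_ip (X n - l) (X n - l)) \<le> e\<^sup>2"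
        by (simp add: ell2_ip_self)
      with mem \<open>e > 0\<close> show ?thesis by (simp add: real_le_lsqrt)
    qed
    then show ?thesis by blast
  qed
  obtain n where "X n - l \<in> ell2" using close[of 1] by auto
  then have "X n - (X n - l) \<in> ell2" by (rule ell2_diff[OF X])
  then have "l \<in> ell2" by simp
  moreover have "(\<lambda>n. sqrt (Re (ell2_ip (X n - l) (X n - l)))) \<longlonglongrightarrow> 0"
  proof (rule LIMSEQ_I)
    fix r :: real assume "r > 0"
    then obtain N where N: "\<forall>n\<ge>N. X n - l \<in> ell2 \<and> sqrt (Re (ell2_ip (X n - l) (X n - l))) \<le> r / 2"
      using close[of "r / 2"] by auto
    have "norm (sqrt (Re (ell2_ip (X n - l) (X n - l))) - 0) < r" if "n \<ge> N" for n
    proof -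
      have "0 \<le> cmod ((X n - l) 0)" by simp
      also have "\<dots> \<le> sqrt (Re (ell2_ip (X n - l) (X n - l)))"
        using N that by (intro ell2_norm_coordinate_le) blast
      finally have "norm (sqrt (Re (ell2_ip (X n - l) (X n - l))) - 0)
          = sqrt (Re (ell2_ip (X n - l) (X n - l)))" by simp
      moreover have "sqrt (Re (ell2_ip (X n - l) (X n - l))) \<le> r / 2" using N that by blast
      ultimately show ?thesis using \<open>r > 0\<close> by linarith
    qed
    then show "\<exists>N. \<forall>n\<ge>N. norm (sqrt (Re (ell2_ip (X n - l) (X n - l))) - 0) < r" by blast
  qed
  ultimately show ?thesis by blast
qed

interpretation ell2: complex_hilbert_space ell2_scale ell2 ell2_ip
proof unfold_locales
  fix x y z :: "nat \<Rightarrow> complex" and c :: complex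
  show "ell2.subspace ell2" by (rule subspace_ell2)
  show "ell2_ip (x + y) z = ell2_ip x z + ell2_ip y z" if "x \<in> ell2" "y \<in> ell2" "z \<in> ell2"
    using suminf_add[OF summable_ell2_ip summable_ell2_ip, of x z y z] that
    by (simp add: ell2_ip_def algebra_simps)
  show "ell2_ip (ell2_scale c x) y = c * ell2_ip x y" if "x \<in> ell2" "y \<in> ell2"
    using suminf_mult[OF summable_ell2_ip, of x y c] that
    by (simp add: ell2_ip_def ell2_scale_def algebra_simps)
  show "ell2_ip y x = cnj (ell2_ip x y)" if "x \<in> ell2" "y \<in> ell2"
  proof -
    have "(\<lambda>k. cnj (x k * cnj (y k))) sums cnj (ell2_ip x y)"
      unfolding sums_cnj ell2_ip_def by (intro summable_sums summable_ell2_ip that)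
    then show ?thesis by (simp add: ell2_ip_def sums_iff mult.commute)
  qed
  show "0 < Re (ell2_ip x x)" if x: "x \<in> ell2" and "x \<noteq> 0"
  proof -
    from \<open>x \<noteq> 0\<close> obtain k where "x k \<noteq> 0" by (auto simp: fun_eq_iff)
    with ell2_norm_coordinate_le[OF x, of k] have "0 < sqrt (Re (ell2_ip x x))"
      by (smt (verit) zero_less_norm_iff)
    then show ?thesis by simp
  qed
qed (rule ell2_complete)

section \<open>A non-closable realisation of multiplication by the variable\<close>

text \<open>
  The coordinates \<open>Suc k\<close> make the map injective, with weights that send the powers of \<open>X\<close> to null
  sequences there; coordinate \<open>0\<close> separates the even powers, on which it vanishes, from the odd
  ones, on which it takes the value 2.
\<close>

definition embed :: "complex poly \<Rightarrow> nat \<Rightarrow> complex" where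
  "embed p = (\<lambda>k. case k of 0 \<Rightarrow> poly p 1 - poly p (- 1)
     | Suc j \<Rightarrow> coeff p j / of_nat (Suc j))"

lemma embed_0: "embed p 0 = poly p 1 - poly p (- 1)"
  and embed_Suc: "embed p (Suc j) = coeff p j / of_nat (Suc j)"
  by (simp_all add: embed_def)

lemma embed_add: "embed (p + q) = embed p + embed q"
  by (rule ext) (simp add: embed_def add_divide_distrib split: nat.split)

lemma embed_smult: "embed (smult c p) = ell2_scale c (embed p)"
  by (rule ext) (simp add: embed_def ell2_scale_def algebra_simps split: nat.split)

lemma inj_embed: "inj embed"
proof (rule injI, rule poly_eqI)
  fix p q j assume "embed p = embed q"
  then have "embed p (Suc j) = embed q (Suc j)" by simp
  then show "coeff p j = coeff q j" by (simp add: embed_Suc del: of_nat_Suc)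
qed

lemma embed_in_ell2: "embed p \<in> ell2"
proof -
  have "summable (\<lambda>k. (cmod (embed p k))\<^sup>2)"
  proof (rule summable_finite)
    show "finite {..Suc (degree p)}" by simp
    fix k assume "k \<notin> {..Suc (degree p)}"
    then obtain j where "k = Suc j" "j > degree p" by (cases k) auto
    then show "(cmod (embed p k))\<^sup>2 = 0" by (simp add: embed_Suc coeff_eq_0)
  qed
  then show ?thesis by (simp add: ell2_def)
qed

definition embedded_X :: "(nat \<Rightarrow> complex) \<rightharpoonup> (nat \<Rightarrow> complex)" where
  "embedded_X x = (if x \<in> range embed then Some (embed (pCons 0 (inv embed x))) else None)"

lemma embedded_X_embed: "embedded_X (embed p) = Some (embed (pCons 0 p))"
  by (simp add: embedded_X_def inv_f_f[OF inj_embed])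

lemma dom_embedded_X: "dom embedded_X = range embed"
  by (auto simp: embedded_X_def dom_def)

lemma ran_embedded_X: "ran embedded_X \<subseteq> range embed"
  by (auto simp: embedded_X_def ran_def)

lemma linear_operator_embedded_X: "ell2.linear_operator embedded_X"
proof -
  have "0 \<in> range embed"
    using embed_smult[of 0 0] by (metis ell2.scale_zero_left rangeI)
  moreover have "x + y \<in> range embed" if "x \<in> range embed" "y \<in> range embed" for x y
    using that by (auto simp: embed_add[symmetric])
  moreover have "ell2_scale c x \<in> range embed" if "x \<in> range embed" for c x
    using that by (auto simp: embed_smult[symmetric])
  ultimately have "ell2.subspace (range embed)" by (simp add: ell2.subspace_def)
  moreover have "the (embedded_X (embed p + embed q))
      = the (embedded_X (embed p)) + the (embedded_X (embed q))" for p q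
    unfolding embed_add[symmetric] embedded_X_embed option.sel by simp
  moreover have "the (embedded_X (ell2_scale c (embed p)))
      = ell2_scale c (the (embedded_X (embed p)))" for c p
    unfolding embed_smult[symmetric] embedded_X_embed option.sel by simp
  ultimately show ?thesis
    using embed_in_ell2 ran_embedded_X
    unfolding ell2.linear_operator_def dom_embedded_X by auto
qed

text \<open>
  The subtracted vector is the limit of the powers of \<open>X\<close> of a fixed parity; the difference has a
  single nonzero coordinate.
\<close>

lemma hnorm_embed_monom:
  "ell2.hnorm (embed (monom 1 n) - (\<lambda>k. if k = 0 then 1 - (- 1) ^ n else 0)) = 1 / real (Suc n)"
proof -
  let ?x = "embed (monom 1 n) - (\<lambda>k. if k = 0 then 1 - (- 1) ^ n else 0)"
  have "?x k * cnj (?x k) = (if k = Suc n then of_real ((1 / real (Suc n))\<^sup>2) else 0)" for k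
    by (cases k) (auto simp: embed_0 embed_Suc poly_monom power2_eq_square)
  then have "ell2_ip ?x ?x = of_real ((1 / real (Suc n))\<^sup>2)"
    unfolding ell2_ip_def by (simp only: sums_unique[OF sums_single, symmetric])
  then show ?thesis by (simp add: ell2.hnorm_def real_sqrt_divide)
qed

text \<open>The even powers of \<open>X\<close> and their images, the odd powers, contradict closability.\<close>

lemma not_closable_embedded_X: "\<not> ell2.closable embedded_X"
proof
  assume closable: "ell2.closable embedded_X"
  define y :: "nat \<Rightarrow> complex" where "y = (\<lambda>k. if k = 0 then 2 else 0)"
  have "y \<in> ell2"
    unfolding ell2_def y_def mem_Collect_eq by (rule summable_finite[of "{0}"]) auto
  moreover have "ell2.converges_to (\<lambda>n. embed (monom 1 (2 * n))) 0"
  proof -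
    have "ell2.hnorm (embed (monom 1 (2 * n)) - 0) = 1 / real (Suc (2 * n))" for n
      using hnorm_embed_monom[of "2 * n"] by (simp add: zero_fun_def cong: if_cong)
    moreover have "(\<lambda>n. 1 / real (Suc (2 * n))) \<longlonglongrightarrow> 0"
      using LIMSEQ_subseq_LIMSEQ[OF LIMSEQ_Suc[OF lim_1_over_n], of "\<lambda>n. 2 * n"]
      by (simp add: o_def strict_mono_def)
    ultimately show ?thesis by (simp add: ell2.converges_to_def)
  qed
  moreover have "ell2.converges_to (\<lambda>n. the (embedded_X (embed (monom 1 (2 * n))))) y"
  proof -
    have "ell2.hnorm (embed (monom 1 (Suc (2 * n))) - y) = 1 / real (Suc (Suc (2 * n)))" for n
      using hnorm_embed_monom[of "Suc (2 * n)"] by (simp add: y_def cong: if_cong)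
    moreover have "(\<lambda>n. 1 / real (Suc (Suc (2 * n)))) \<longlonglongrightarrow> 0"
      using LIMSEQ_subseq_LIMSEQ[OF LIMSEQ_Suc[OF lim_1_over_n], of "\<lambda>n. Suc (2 * n)"]
      by (simp add: o_def strict_mono_def)
    ultimately show ?thesis
      by (simp add: ell2.converges_to_def embedded_X_embed monom_Suc)
  qed
  ultimately have "y = 0"
    using closable[unfolded ell2.closable_def, rule_format,
        of y "\<lambda>n. embed (monom 1 (2 * n))"]
    by (simp add: dom_embedded_X)
  then have "y 0 = 0" by simp
  then show False by (simp add: y_def)
qed

lemma embedded_X_no_square_root:
  assumes linear: "ell2.linear_operator B" and root: "ell2.square_root B embedded_X"
  shows False
proof -
  have BB: "B \<circ>\<^sub>m B = embedded_X" using root by (simp add: ell2.square_root_def)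
  have inv: "ran embedded_X \<subseteq> dom embedded_X"
    using ran_embedded_X by (simp add: dom_embedded_X)
  note maps = square_root_maps_domain[OF BB inv, unfolded dom_embedded_X, OF rangeI]
  define C where "C p = inv embed (the (B (embed p)))" for p
  have C: "embed (C p) = the (B (embed p))" for p
    unfolding C_def using maps(2) by (rule f_inv_into_f)
  have embed_eqI: "p = q" if "embed p = embed q" for p q
    using that inj_embed by (simp add: inj_eq)
  have "C (p + q) = C p + C q" for p q
    by (rule embed_eqI)
      (use linear maps(1) in \<open>simp add: C embed_add ell2.linear_operator_def\<close>)
  moreover have "C (smult a p) = smult a (C p)" for a p
    by (rule embed_eqI)
      (use linear maps(1) in \<open>simp add: C embed_smult ell2.linear_operator_def\<close>)
  moreover have "C (C p) = pCons 0 p" for p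
    by (rule embed_eqI) (simp add: C maps(3) embedded_X_embed)
  ultimately show False by (rule mult_X_no_square_root)
qed

theorem proposition1p8:
  "\<exists>(scale :: complex \<Rightarrow> (nat \<Rightarrow> complex) \<Rightarrow> (nat \<Rightarrow> complex))
     (H :: (nat \<Rightarrow> complex) set)
     (ip :: (nat \<Rightarrow> complex) \<Rightarrow> (nat \<Rightarrow> complex) \<Rightarrow> complex)
     (A :: (nat \<Rightarrow> complex) \<rightharpoonup> (nat \<Rightarrow> complex)).
     complex_hilbert_space scale H ip \<and>
     complex_hilbert_space.linear_operator scale H A \<and>
     \<not> complex_hilbert_space.closable H ip A \<and>
     \<not> (\<exists>B. complex_hilbert_space.linear_operator scale H B \<and>
            complex_hilbert_space.closable H ip B \<and>
            complex_hilbert_space.square_root B A)"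
  using ell2.complex_hilbert_space_axioms linear_operator_embedded_X not_closable_embedded_X
    embedded_X_no_square_root
  by blast

end
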